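(* Let $N\ge2$, $m_1,\dots,m_N\in\{+1,-1\}$, $M_0=\sum_{1\le j<l\le N}m_jm_l$, and for $\mathbf X=(\mathbf x_1,\dots,\mathbf x_N)\in\mathbb R^{2\times N}$ and $t\ge0$ define $$H_1(\mathbf X,t)=-4NM_0t+\sum_{1\le j<l\le N}|\mathbf x_j-\mathbf x_l|^2,\qquad H_2(\mathbf X,t)=-4M_0t+\sum_{j=1}^N|\mathbf x_j|^2,$$ $$H_3(\mathbf X,t)=-4(N-2)M_0t+\sum_{1\le j<l\le N}|\mathbf x_j+\mathbf x_l|^2 .$$ Let $\mathbf X^0=(\mathbf x_1^0,\dots,\mathbf x_N^0)\in\mathbb R_*^{2\times N}$ and let $\mathbf X(t)=(\mathbf x_1(t),\dots,\mathbf x_N(t))\in\mathbb R_*^{2\times N}$, $0\le t<T_{\max}$, be the solution of $$\dot{\mathbf x}_j(t)=2m_j\sum_{k=1,k\ne j}^N m_k\frac{\mathbf x_j(t)-\mathbf x_k(t)}{|\mathbf x_j(t)-\mathbf x_k(t)|^2},\qquad \mathbf x_j(0)=\mathbf x_j^0,\qquad 1\le j\le N .$$ Then $H_1,H_2,H_3$ are non-autonomous first integrals of this system, i.e. for all $0\le t<T_{\max}$, $$H_1(\mathbf X(t),t)=\sum_{1\le j<l\le N}|\mathbf x_j^0-\mathbf x_l^0|^2,\quad H_2(\mathbf X(t),t)=\sum_{j=1}^N|\mathbf x_j^0|^2,\quad H_3(\mathbf X(t),t)=\sum_{1\le j<l\le N}|\mathbf x_j^0+\mathbf x_l^0|^2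 .$$ Specifically, when $M_0=0$, $\sum_{1\le j<l\le N}|\mathbf x_j-\mathbf x_l|^2$ and $\sum_{j=1}^N|\mathbf x_j|^2$ are two autonomous first integrals of the system; and when either $N=2$ or $M_0=0$, $\sum_{1\le j<l\le N}|\mathbf x_j+\mathbf x_l|^2$ is an autonomous first integral of the system.
   Context: $\mathbb R_*^{2\times N}:=\{(\mathbf x_1,\dots,\mathbf x_N)\in\mathbb R^{2\times N} : \mathbf x_j\neq\mathbf x_l\in\mathbb R^2 \text{ for } 1\le j<l\le N\}$. $T_{\max}:=\sup\{t\ge 0 : \mathbf x_j(t)\ne\mathbf x_l(t)\text{ for all }1\le j\ne l\le N\}\in(0,+\infty]$; the solution exists on $[0,T_{\max})$. A first integral is a function constant along every solution (autonomous if it does not depend explicitly on $t$). *)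

theory Defs
  imports "HOL-Analysis.Analysis" "HOL-Library.Extended_Real"
begin

text \<open>
  A configuration of \<open>N\<close> points in the plane is an element of \<^typ>\<open>real^2^'n\<close> with
  \<open>N = CARD('n)\<close>. The linear order on \<open>'n\<close> only serves to enumerate the pairs \<open>j < l\<close>.
\<close>

definition noncolliding :: "(real^2^('n::finite)) set" where
  "noncolliding = {X. \<forall>j l. j \<noteq> l \<longrightarrow> X $ j \<noteq> X $ l}"

definition M0 :: "('n::{finite,linorder} \<Rightarrow> real) \<Rightarrow> real" where
  "M0 m = (\<Sum>(j, l) | j < l. m j * m l)"

definition velocity :: "('n::finite \<Rightarrow> real) \<Rightarrow> real^2^('n::finite) \<Rightarrow> 'n \<Rightarrow> real^2" where
  "velocity m X j =
     (2 * m j) *\<^sub>R (\<Sum>k\<in>UNIV - {j}. m k *\<^sub>R ((X $ j - X $ k) /\<^sub>R (norm (X $ j - X $ k))\<^sup>2))"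

text \<open>
  Trajectories are total functions of time, but only their values on the interval \<open>I\<close> are
  constrained; at the endpoint \<open>0\<close> the derivative is one-sided.
\<close>

definition solution_on :: "('n::finite \<Rightarrow> real) \<Rightarrow> real set \<Rightarrow> (real \<Rightarrow> real^2^('n::finite)) \<Rightarrow> bool" where
  "solution_on m I X \<longleftrightarrow>
     (\<forall>t\<in>I. X t \<in> noncolliding \<and>
        (\<forall>j. ((\<lambda>s. X s $ j) has_vector_derivative velocity m (X t) j) (at t within I)))"

definition time_interval :: "ereal \<Rightarrow> real set" where
  "time_interval T = {t. 0 \<le> t \<and> ereal t < T}"

text \<open>
  The solution with initial data \<open>X0\<close> is unique as long as it exists, so the supremum of the
  times at which it has not collided is the supremum of the \<open>t\<close> for which a
  collision-free solution exists on \<open>[0, t]\<close>.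
\<close>

definition T_max :: "('n::finite \<Rightarrow> real) \<Rightarrow> real^2^('n::finite) \<Rightarrow> ereal" where
  "T_max m X0 = Sup (ereal ` {t. 0 \<le> t \<and> (\<exists>Y. Y 0 = X0 \<and> solution_on m {0..t} Y)})"

definition first_integral ::
    "('n::finite \<Rightarrow> real) \<Rightarrow> (real^2^('n::finite) \<Rightarrow> real \<Rightarrow> real) \<Rightarrow> bool" where
  "first_integral m F \<longleftrightarrow>
     (\<forall>T X. 0 < T \<longrightarrow> solution_on m (time_interval T) X \<longrightarrow>
        (\<forall>t\<in>time_interval T. F (X t) t = F (X 0) 0))"

definition autonomous_first_integral ::
    "('n::finite \<Rightarrow> real) \<Rightarrow> (real^2^('n::finite) \<Rightarrow> real) \<Rightarrow> bool" where
  "autonomous_first_integral m G \<longleftrightarrow> first_integral m (\<lambda>X t. G X)"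

definition H1 :: "('n::{finite,linorder} \<Rightarrow> real) \<Rightarrow> real^2^('n::{finite,linorder}) \<Rightarrow> real \<Rightarrow> real" where
  "H1 m X t = - 4 * real CARD('n) * M0 m * t + (\<Sum>(j, l) | j < l. (norm (X $ j - X $ l))\<^sup>2)"

definition H2 :: "('n::{finite,linorder} \<Rightarrow> real) \<Rightarrow> real^2^('n::{finite,linorder}) \<Rightarrow> real \<Rightarrow> real" where
  "H2 m X t = - 4 * M0 m * t + (\<Sum>j\<in>UNIV. (norm (X $ j))\<^sup>2)"

definition H3 :: "('n::{finite,linorder} \<Rightarrow> real) \<Rightarrow> real^2^('n::{finite,linorder}) \<Rightarrow> real \<Rightarrow> real" where
  "H3 m X t =
     - 4 * (real CARD('n) - 2) * M0 m * t + (\<Sum>(j, l) | j < l. (norm (X $ j + X $ l))\<^sup>2)"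

end

theory Submission imports Defs begin

text \<open>
  Pairing the \<open>(j, k)\<close> and \<open>(k, j)\<close> terms of the interaction gives
  \<open>\<Sum>j. x j' = 0\<close> and \<open>\<Sum>j. x j \<bullet> x j' = 2 * M0\<close>. Hence the centre \<open>\<Sum>j. x j\<close> is conserved and
  \<open>\<Sum>j. \<bar>x j\<bar>\<^sup>2\<close> grows at the constant rate \<open>4 * M0\<close>; the two pair sums are combinations of
  \<open>\<Sum>j. \<bar>x j\<bar>\<^sup>2\<close> and \<open>\<bar>\<Sum>j. x j\<bar>\<^sup>2\<close>.
\<close>

text \<open>The off-diagonal pairs split into \<open>j < k\<close> and \<open>k < j\<close>, and
  swapping coordinates carries the second half onto the first. This brings each term together with
  its mirror image, so that symmetries of \<open>f\<close> can act inside a pair.\<close>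

lemma sum_offdiag_eq_sum_pairs:
  fixes f :: "'n::{finite,linorder} \<Rightarrow> 'n \<Rightarrow> 'a::comm_monoid_add"
  shows "(\<Sum>j\<in>UNIV. \<Sum>k\<in>UNIV - {j}. f j k) = (\<Sum>(j, l) | j < l. f j l + f l j)"
proof -
  have "(\<Sum>j\<in>UNIV. \<Sum>k\<in>UNIV - {j}. f j k) = (\<Sum>(j, k)\<in>(SIGMA j:UNIV. UNIV - {j}). f j k)"
    by (simp add: sum.Sigma)
  also have "(SIGMA j:UNIV. UNIV - {j}) = {(j, l). j < l} \<union> {(j, l). l < (j::'n)}"
    by auto
  also have "(\<Sum>(j, k)\<in>\<dots>. f j k) = (\<Sum>(j, l) | j < l. f j l) + (\<Sum>(j, l) | l < j. f j l)"
    by (rule sum.union_disjoint) auto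
  also have "(\<Sum>(j, l) | l < j. f j l) = (\<Sum>(j, l) | j < l. f l j)"
    by (rule sum.reindex_bij_witness[where i = prod.swap and j = prod.swap]) auto
  finally show ?thesis
    by (simp add: sum.distrib case_prod_unfold)
qed

text \<open>Every index lies in exactly \<open>CARD('n) - 1\<close> pairs. In the double sum this
  appears as a summand that does not depend on \<open>k\<close>.\<close>

lemma sum_pairs_norm_sq:
  fixes x :: "'n::{finite,linorder} \<Rightarrow> 'a::real_inner"
  shows "(\<Sum>(j, l) | j < l. (norm (x j))\<^sup>2 + (norm (x l))\<^sup>2)
    = (real CARD('n) - 1) * (\<Sum>j\<in>UNIV. (norm (x j))\<^sup>2)"
proof -
  have "(\<Sum>(j, l) | j < l. (norm (x j))\<^sup>2 + (norm (x l))\<^sup>2)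
      = (\<Sum>j\<in>UNIV. \<Sum>k\<in>UNIV - {j}. (norm (x j))\<^sup>2)"
    by (rule sum_offdiag_eq_sum_pairs[symmetric])
  also have "\<dots> = (\<Sum>j\<in>UNIV. (real CARD('n) - 1) * (norm (x j))\<^sup>2)"
    by (simp add: card_Diff_singleton of_nat_diff Suc_leI)
  finally show ?thesis
    by (simp add: sum_distrib_left)
qed

text \<open>Expanding the squared norm of the sum bilinearly leaves the diagonal plus each pair
  counted twice.\<close>

lemma sum_pairs_inner:
  fixes x :: "'n::{finite,linorder} \<Rightarrow> 'a::real_inner"
  shows "(\<Sum>(j, l) | j < l. 2 * (x j \<bullet> x l))
    = (norm (\<Sum>j\<in>UNIV. x j))\<^sup>2 - (\<Sum>j\<in>UNIV. (norm (x j))\<^sup>2)"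
proof -
  have "(\<Sum>(j, l) | j < l. 2 * (x j \<bullet> x l)) = (\<Sum>(j, l) | j < l. x j \<bullet> x l + x l \<bullet> x j)"
    by (simp add: inner_commute)
  also have "\<dots> = (\<Sum>j\<in>UNIV. \<Sum>k\<in>UNIV - {j}. x j \<bullet> x k)"
    by (rule sum_offdiag_eq_sum_pairs[symmetric])
  also have "\<dots> = (\<Sum>j\<in>UNIV. (\<Sum>k\<in>UNIV. x j \<bullet> x k) - x j \<bullet> x j)"
    by (simp add: sum_diff1)
  also have "\<dots> = (\<Sum>j\<in>UNIV. x j) \<bullet> (\<Sum>k\<in>UNIV. x k) - (\<Sum>j\<in>UNIV. x j \<bullet> x j)"
    unfolding inner_sum_left by (simp add: sum_subtractf inner_sum_right)
  finally show ?thesis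
    by (simp add: power2_norm_eq_inner)
qed

text \<open>Expand each square: the square terms contribute the factor \<open>N - 1\<close>, and
  subtracting the cross terms adds one more, giving \<open>N\<close>.\<close>

lemma sum_pairs_norm_diff_sq:
  fixes x :: "'n::{finite,linorder} \<Rightarrow> 'a::real_inner"
  shows "(\<Sum>(j, l) | j < l. (norm (x j - x l))\<^sup>2)
    = real CARD('n) * (\<Sum>j\<in>UNIV. (norm (x j))\<^sup>2) - (norm (\<Sum>j\<in>UNIV. x j))\<^sup>2"
proof -
  have "(\<Sum>(j, l) | j < l. (norm (x j - x l))\<^sup>2)
      = (\<Sum>(j, l) | j < l. (norm (x j))\<^sup>2 + (norm (x l))\<^sup>2) - (\<Sum>(j, l) | j < l. 2 * (x j \<bullet> x l))"
    unfolding sum_subtractf[symmetric]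
    by (rule sum.cong) (auto simp: power2_norm_eq_inner inner_diff inner_commute)
  then show ?thesis
    unfolding sum_pairs_norm_sq sum_pairs_inner by (simp add: algebra_simps)
qed

text \<open>Here the cross terms enter with a plus sign and lower the factor from
  \<open>N - 1\<close> to \<open>N - 2\<close>; this is the source of \<open>N - 2\<close> in
  \<open>H3\<close>.\<close>

lemma sum_pairs_norm_add_sq:
  fixes x :: "'n::{finite,linorder} \<Rightarrow> 'a::real_inner"
  shows "(\<Sum>(j, l) | j < l. (norm (x j + x l))\<^sup>2)
    = (real CARD('n) - 2) * (\<Sum>j\<in>UNIV. (norm (x j))\<^sup>2) + (norm (\<Sum>j\<in>UNIV. x j))\<^sup>2"
proof -
  have "(\<Sum>(j, l) | j < l. (norm (x j + x l))\<^sup>2)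
      = (\<Sum>(j, l) | j < l. (norm (x j))\<^sup>2 + (norm (x l))\<^sup>2) + (\<Sum>(j, l) | j < l. 2 * (x j \<bullet> x l))"
    unfolding sum.distrib[symmetric]
    by (rule sum.cong) (auto simp: power2_norm_eq_inner inner_add inner_commute)
  then show ?thesis
    unfolding sum_pairs_norm_sq sum_pairs_inner by (simp add: algebra_simps)
qed

lemma sum_velocity:
  fixes m :: "'n::{finite,linorder} \<Rightarrow> real"
  shows "(\<Sum>j\<in>UNIV. velocity m X j) = 0"
proof -
  \<comment> \<open>All scalars are collected into one weight symmetric in \<open>j\<close> and
    \<open>k\<close>, so the antisymmetry of \<open>X $ j - X $ k\<close> makes \<open>f\<close>
    antisymmetric.\<close>
  define f where
    "f j k = (2 * m j * m k / (norm (X $ j - X $ k))\<^sup>2) *\<^sub>R (X $ j - X $ k)" for j k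
  have "f j k + f k j = 0" for j k
    unfolding f_def norm_minus_commute[of "X $ k" "X $ j"]
    by (simp add: mult_ac flip: scaleR_add_right)
  moreover have "velocity m X j = (\<Sum>k\<in>UNIV - {j}. f j k)" for j
    by (simp add: velocity_def f_def scaleR_sum_right divide_inverse mult_ac)
  ultimately show ?thesis
    by (simp add: sum_offdiag_eq_sum_pairs case_prod_unfold)
qed

text \<open>Within a pair the two inner products add up to the squared distance, which cancels the
  denominator. Noncollision makes that denominator nonzero; otherwise the quotient would be 0 by
  convention and the pair would be lost.\<close>

lemma sum_inner_velocity:
  fixes m :: "'n::{finite,linorder} \<Rightarrow> real"
  assumes "X \<in> noncolliding"
  shows "(\<Sum>j\<in>UNIV. X $ j \<bullet> velocity m X j) = 2 * M0 m"
proof -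
  define f where
    "f j k = 2 * m j * m k / (norm (X $ j - X $ k))\<^sup>2 * (X $ j \<bullet> (X $ j - X $ k))" for j k
  have "f j k + f k j = 2 * (m j * m k)" if "j < k" for j k
  proof -
    have "(norm (X $ j - X $ k))\<^sup>2 \<noteq> 0"
      using assms that by (auto simp: noncolliding_def)
    moreover have "f j k + f k j = 2 * m j * m k / (norm (X $ j - X $ k))\<^sup>2
        * (X $ j \<bullet> (X $ j - X $ k) + X $ k \<bullet> (X $ k - X $ j))"
      unfolding f_def norm_minus_commute[of "X $ k" "X $ j"] by (simp add: ring_distribs mult_ac)
    moreover have "X $ j \<bullet> (X $ j - X $ k) + X $ k \<bullet> (X $ k - X $ j) = (norm (X $ j - X $ k))\<^sup>2"
      by (simp add: power2_norm_eq_inner inner_diff inner_commute)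
    ultimately show ?thesis
      by simp
  qed
  moreover have "X $ j \<bullet> velocity m X j = (\<Sum>k\<in>UNIV - {j}. f j k)" for j
    by (simp add: velocity_def f_def inner_sum_right sum_distrib_left divide_inverse mult_ac)
  ultimately show ?thesis
    by (auto simp: sum_offdiag_eq_sum_pairs M0_def sum_distrib_left intro!: sum.cong)
qed

text \<open>Convexity is what allows a vanishing derivative to force constancy on the
  interval.\<close>

lemma convex_time_interval: "convex (time_interval T)"
proof (cases T)
  case (real r)
  then have "time_interval T = {0..<r}"
    by (auto simp: time_interval_def)
  then show ?thesis
    by simp
next
  case PInf
  then have "time_interval T = {0..}"
    by (auto simp: time_interval_def)
  then show ?thesis
    by simp
next
  case MInf
  then have "time_interval T = {}"
    by (auto simp: time_interval_def)
  then show ?thesis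
    by simp
qed

lemma solution_sum_const:
  fixes m :: "'n::{finite,linorder} \<Rightarrow> real"
  assumes "solution_on m I X" "convex I" "s \<in> I" "t \<in> I"
  shows "(\<Sum>j\<in>UNIV. X t $ j) = (\<Sum>j\<in>UNIV. X s $ j)"
proof -
  have "((\<lambda>r. \<Sum>j\<in>UNIV. X r $ j) has_vector_derivative 0) (at r within I)" if "r \<in> I" for r
  proof -
    have "((\<lambda>r. \<Sum>j\<in>UNIV. X r $ j) has_vector_derivative (\<Sum>j\<in>UNIV. velocity m (X r) j))
        (at r within I)"
      using assms(1) that by (intro has_vector_derivative_sum) (auto simp: solution_on_def)
    then show ?thesis
      by (simp add: sum_velocity)
  qed
  then obtain c where "\<And>r. r \<in> I \<Longrightarrow> (\<Sum>j\<in>UNIV. X r $ j) = c"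
    by (rule has_vector_derivative_zero_constant[OF assms(2)]) metis+
  then show ?thesis
    using assms(3,4) by simp
qed

lemma solution_sum_norm_sq:
  fixes m :: "'n::{finite,linorder} \<Rightarrow> real"
  assumes "solution_on m I X" "convex I" "0 \<in> I" "t \<in> I"
  shows "(\<Sum>j\<in>UNIV. (norm (X t $ j))\<^sup>2) = 4 * M0 m * t + (\<Sum>j\<in>UNIV. (norm (X 0 $ j))\<^sup>2)"
proof -
  \<comment> \<open>Subtracting the expected linear growth reduces the claim to constancy. The
    product rule gives two equal copies of the sum \<open>2 * M0 m\<close>, hence the rate
    \<open>4 * M0 m\<close>.\<close>
  have "((\<lambda>r. (\<Sum>j\<in>UNIV. X r $ j \<bullet> X r $ j) - 4 * M0 m * r) has_vector_derivative 0) (at r within I)"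
    if "r \<in> I" for r
  proof -
    have X: "X r \<in> noncolliding"
      and D: "((\<lambda>r. X r $ j) has_vector_derivative velocity m (X r) j) (at r within I)" for j
      using assms(1) that by (auto simp: solution_on_def)
    have "((\<lambda>r. (\<Sum>j\<in>UNIV. X r $ j \<bullet> X r $ j) - 4 * M0 m * r) has_vector_derivative
        (\<Sum>j\<in>UNIV. X r $ j \<bullet> velocity m (X r) j + velocity m (X r) j \<bullet> X r $ j) - 4 * M0 m * 1)
        (at r within I)"
      by (intro has_vector_derivative_diff has_vector_derivative_sum has_vector_derivative_mult_right
          has_vector_derivative_id bounded_bilinear.has_vector_derivative[OF bounded_bilinear_inner] D)
    then show ?thesis
      by (simp add: inner_commute[of "velocity _ _ _"] sum_inner_velocity[OF X] flip: sum_distrib_left)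
  qed
  then obtain c where c: "\<And>r. r \<in> I \<Longrightarrow> (\<Sum>j\<in>UNIV. X r $ j \<bullet> X r $ j) - 4 * M0 m * r = c"
    by (rule has_vector_derivative_zero_constant[OF assms(2)]) metis+
  from c[OF assms(3)] c[OF assms(4)] show ?thesis
    by (simp add: power2_norm_eq_inner)
qed

lemma first_integral_H:
  fixes m :: "'n::{finite,linorder} \<Rightarrow> real"
  shows "first_integral m (H1 m)" "first_integral m (H2 m)" "first_integral m (H3 m)"
proof -
  have "H1 m (X t) t = H1 m (X 0) 0 \<and> H2 m (X t) t = H2 m (X 0) 0 \<and> H3 m (X t) t = H3 m (X 0) 0"
    if "0 < T" "solution_on m (time_interval T) X" "t \<in> time_interval T" for T X t
  proof -
    have 0: "0 \<in> time_interval T"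
      using that(1) by (simp add: time_interval_def zero_ereal_def)
    note S = solution_sum_const[OF that(2) convex_time_interval 0 that(3)]
      and Q = solution_sum_norm_sq[OF that(2) convex_time_interval 0 that(3)]
    \<comment> \<open>The sum of squares enters \<open>H1\<close>, \<open>H2\<close>,
      \<open>H3\<close> with coefficients \<open>N\<close>, 1, \<open>N - 2\<close>, so its growth
      \<open>4 * M0 m * t\<close> cancels the explicit time terms; the centre contributes only a
      constant.\<close>
    show ?thesis
      unfolding H1_def H2_def H3_def sum_pairs_norm_diff_sq sum_pairs_norm_add_sq S Q
      by (simp add: algebra_simps)
  qed
  then show "first_integral m (H1 m)" "first_integral m (H2 m)" "first_integral m (H3 m)"
    unfolding first_integral_def by blast+
qed

theorem lemma2p4:
  fixes m :: "'n::{finite,linorder} \<Rightarrow> real"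
  assumes "CARD('n) \<ge> 2"
    and "\<And>j. m j \<in> {1, -1}"
  shows "first_integral m (H1 m) \<and> first_integral m (H2 m) \<and> first_integral m (H3 m)
    \<and> (\<forall>X0\<in>noncolliding. \<forall>X.
         X 0 = X0 \<longrightarrow> solution_on m (time_interval (T_max m X0)) X \<longrightarrow>
         (\<forall>t\<in>time_interval (T_max m X0).
            H1 m (X t) t = (\<Sum>(j, l) | j < l. (norm (X0 $ j - X0 $ l))\<^sup>2)
          \<and> H2 m (X t) t = (\<Sum>j\<in>UNIV. (norm (X0 $ j))\<^sup>2)
          \<and> H3 m (X t) t = (\<Sum>(j, l) | j < l. (norm (X0 $ j + X0 $ l))\<^sup>2)))
    \<and> (M0 m = 0 \<longrightarrow>
         autonomous_first_integral m (\<lambda>X. \<Sum>(j, l) | j < l. (norm (X $ j - X $ l))\<^sup>2)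
       \<and> autonomous_first_integral m (\<lambda>X. \<Sum>j\<in>UNIV. (norm (X $ j))\<^sup>2))
    \<and> (CARD('n) = 2 \<or> M0 m = 0 \<longrightarrow>
         autonomous_first_integral m (\<lambda>X. \<Sum>(j, l) | j < l. (norm (X $ j + X $ l))\<^sup>2))"
proof (intro conjI ballI allI impI)
  show "first_integral m (H1 m)" "first_integral m (H2 m)" "first_integral m (H3 m)"
    by (rule first_integral_H)+
next
  fix X0 X t
  assume X: "X 0 = X0" "solution_on m (time_interval (T_max m X0)) X"
    and t: "t \<in> time_interval (T_max m X0)"
  \<comment> \<open>Positivity comes from the given time \<open>t\<close>, since
    \<open>0 \<le> t < T_max m X0\<close>; no local existence result enters.\<close>
  have "0 < T_max m X0"
    using t by (auto simp: time_interval_def zero_ereal_def intro: le_less_trans[of _ "ereal t"])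
  then have *: "F (X t) t = F X0 0" if "first_integral m F" for F
    using that X t unfolding first_integral_def by blast
  show "H1 m (X t) t = (\<Sum>(j, l) | j < l. (norm (X0 $ j - X0 $ l))\<^sup>2)"
    "H2 m (X t) t = (\<Sum>j\<in>UNIV. (norm (X0 $ j))\<^sup>2)"
    "H3 m (X t) t = (\<Sum>(j, l) | j < l. (norm (X0 $ j + X0 $ l))\<^sup>2)"
    using first_integral_H[THEN *] by (simp_all add: H1_def H2_def H3_def)
next
  assume "M0 m = 0"
  then show "autonomous_first_integral m (\<lambda>X. \<Sum>(j, l) | j < l. (norm (X $ j - X $ l))\<^sup>2)"
    "autonomous_first_integral m (\<lambda>X. \<Sum>j\<in>UNIV. (norm (X $ j))\<^sup>2)"
    using first_integral_H(1,2)[of m]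
    by (simp_all add: autonomous_first_integral_def first_integral_def H1_def H2_def)
next
  \<comment> \<open>Either alternative annihilates the time coefficient
    \<open>- 4 * (N - 2) * M0 m\<close>, so \<open>H3\<close> is the pair sum itself.\<close>
  assume "CARD('n) = 2 \<or> M0 m = 0"
  then show "autonomous_first_integral m (\<lambda>X. \<Sum>(j, l) | j < l. (norm (X $ j + X $ l))\<^sup>2)"
    using first_integral_H(3)[of m]
    by (auto simp: autonomous_first_integral_def first_integral_def H3_def)
qed

end
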